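(* The sequence $$f(n+2)=\Omega_{n+2}^{1/((n+2)\ln(n+2))},\qquad n=0,1,\ldots,$$ is a Hausdorff moment sequence tending to $e^{-1/2}$ as $n\to\infty$.
   Context: $\Omega_n=\dfrac{\pi^{n/2}}{\Gamma(1+n/2)}$ is the volume of the unit ball in $\mathbb R^n$, and $f(x)=\left(\dfrac{\pi^{x/2}}{\Gamma(1+x/2)}\right)^{1/(x\ln x)}$ for $x>1$. A sequence $\{a_n\}_{n\ge 0}$ of positive numbers is a Hausdorff moment sequence if there is a positive measure $\sigma$ on $[0,1]$ such that $a_n=\int_0^1 x^n\,d\sigma(x)$ for all $n\ge 0$. *)

theory Defs
  imports "HOL-Analysis.Analysis"
begin

text \<open>
  The measure \<open>\<sigma>\<close> lives on the Borel sets of \<open>{0..1}\<close>, so its space is \<open>{0..1}\<close>.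
  Finiteness of \<open>\<sigma>\<close> is not assumed: it follows from the existence of the moment of order 0.
  \<open>has_bochner_integral\<close> (rather than an equation for \<open>integral\<^sup>L\<close>) makes existence of the
  moments part of the condition. Note that \<open>0 ^ 0 = 1\<close>, so an atom at 0 contributes to
  \<open>a 0\<close> only.
\<close>
definition hausdorff_moment_sequence :: "(nat \<Rightarrow> real) \<Rightarrow> bool" where
  "hausdorff_moment_sequence a \<longleftrightarrow>
     (\<forall>n. a n > 0) \<and>
     (\<exists>\<sigma> :: real measure.
        sets \<sigma> = sets (restrict_space borel {0..1}) \<and>
        (\<forall>n. has_bochner_integral \<sigma> (\<lambda>x. x ^ n) (a n)))"

text \<open>Only the values at \<open>x > 1\<close> are meaningful.\<close>
definition ball_vol_root :: "real \<Rightarrow> real" where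
  "ball_vol_root x = (pi powr (x / 2) / Gamma (1 + x / 2)) powr (1 / (x * ln x))"

lemma ball_vol_root_altdef: "ball_vol_root x = unit_ball_vol x powr (1 / (x * ln x))"
  by (simp add: ball_vol_root_def unit_ball_vol_def add.commute)

end

theory Submission
  imports Defs "HOL-Probability.Helly_Selection" "HOL-Probability.Probability_Mass_Function"
    "HOL-Real_Asymp.Real_Asymp"
begin

text \<open>
  By Hausdorff's moment theorem it suffices that all iterates of the difference
  \<open>a n - a (n + 1)\<close> are nonnegative. Sequences with this property are closed under sums, products,
  \<open>exp\<close>, integrals and pointwise limits, so that it is enough to show that
  \<open>ln (ball_vol_root x) + 1 / 2\<close>, \<open>x = n + 2\<close>, has it. Write
  \<open>ln (Gamma (1 + z)) = (z + 1 / 2) * ln z - z - L + 1 / (8 * z) - R z\<close> with the limit \<open>L\<close> chosen such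
  that \<open>R\<close> vanishes at infinity; \<open>R\<close> is a sum of manifestly completely monotone integrals. With
  \<open>E = 1 / ln x\<close>, \<open>A = - L - ln 2 / 2\<close> and \<open>B = ln pi / 2 + ln 2 - 1 / 4 + L\<close> this gives
  \<open>ln (ball_vol_root x) + 1 / 2 =
    A * (1 - 1 / x) * E + (1 - 1 / x\<^sup>2) * E / 4 + R (x / 2) * E / x + B * E + (E - 1 / x) / 2\<close>.
  Here \<open>(1 - 1 / x) * E\<close> is the integral of \<open>x powr (- s)\<close>, and \<open>E - 1 / (x - 1)\<close> that of
  \<open>(x powr s - 1) / (x - 1)\<close>, over \<open>s\<close> in \<open>{0..1}\<close>, so both have the property. For
  \<open>A, B \<ge> 0\<close> crude bounds on \<open>L\<close> are enough, and its value \<open>- ln (2 * pi) / 2\<close> is not needed.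
\<close>

subsection \<open>Completely monotone sequences\<close>

definition bdiff :: "(nat \<Rightarrow> real) \<Rightarrow> nat \<Rightarrow> real" where
  "bdiff a n = a n - a (Suc n)"

text \<open>Truncation at a finite order, so that products and reciprocals can be handled by
  induction on the order.\<close>

definition cm_upto :: "nat \<Rightarrow> (nat \<Rightarrow> real) \<Rightarrow> bool" where
  "cm_upto k a \<longleftrightarrow> (\<forall>j\<le>k. \<forall>n. 0 \<le> (bdiff ^^ j) a n)"

definition cm :: "(nat \<Rightarrow> real) \<Rightarrow> bool" where
  "cm a \<longleftrightarrow> (\<forall>k n. 0 \<le> (bdiff ^^ k) a n)"

lemma cm_iff_cm_upto: "cm a \<longleftrightarrow> (\<forall>k. cm_upto k a)"
  by (auto simp: cm_def cm_upto_def)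

section \<open>Linearity and continuity of iterated differences\<close>

lemma bdiff_funpow_add: "(bdiff ^^ k) (\<lambda>n. a n + b n) n = (bdiff ^^ k) a n + (bdiff ^^ k) b n"
  by (induction k arbitrary: n) (simp_all add: bdiff_def)

lemma bdiff_funpow_cmult: "(bdiff ^^ k) (\<lambda>n. c * a n) n = c * (bdiff ^^ k) a n"
  by (induction k arbitrary: n) (simp_all add: bdiff_def algebra_simps)

lemma bdiff_funpow_shift: "(bdiff ^^ k) (\<lambda>n. a (Suc n)) n = (bdiff ^^ k) a (Suc n)"
  by (induction k arbitrary: n) (simp_all add: bdiff_def)

text \<open>A difference of fixed order is a finite linear combination of terms, so it commutes with
  pointwise limits; the same reason gives the version for integrals below.\<close>

lemma bdiff_funpow_tendsto:
  assumes "\<And>n. (\<lambda>N. f N n) \<longlonglongrightarrow> a n"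
  shows "(\<lambda>N. (bdiff ^^ k) (f N) n) \<longlonglongrightarrow> (bdiff ^^ k) a n"
  by (induction k arbitrary: n) (auto simp: bdiff_def intro!: tendsto_intros assms)

lemma bdiff_funpow_has_integral:
  fixes f :: "real \<Rightarrow> nat \<Rightarrow> real"
  assumes "\<And>n. ((\<lambda>t. f t n) has_integral a n) S"
  shows "((\<lambda>t. (bdiff ^^ k) (f t) n) has_integral (bdiff ^^ k) a n) S"
  by (induction k arbitrary: n) (auto simp: bdiff_def intro!: has_integral_diff assms)

text \<open>Discrete Leibniz rule: the difference of a product is
  \<open>bdiff a n * b n + a (Suc n) * bdiff b n\<close>. All four factors keep nonnegative
  differences up to order \<open>k\<close>, so the induction hypothesis applies to both
  products.\<close>

lemma cm_upto_mult:
  assumes "cm_upto k a" "cm_upto k b"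
  shows "cm_upto k (\<lambda>n. a n * b n)"
  using assms
proof (induction k arbitrary: a b)
  case 0
  then show ?case by (simp add: cm_upto_def)
next
  case (Suc k)
  have up: "cm_upto k c" "cm_upto k (bdiff c)" "cm_upto k (\<lambda>n. c (Suc n))" if "cm_upto (Suc k) c" for c
  proof -
    show "cm_upto k c" using that by (simp add: cm_upto_def)
    show "cm_upto k (\<lambda>n. c (Suc n))" using that by (simp add: cm_upto_def bdiff_funpow_shift)
    show "cm_upto k (bdiff c)"
      unfolding cm_upto_def
    proof (intro allI impI)
      fix j n assume "j \<le> k"
      then show "0 \<le> (bdiff ^^ j) (bdiff c) n"
        using that[unfolded cm_upto_def, rule_format, of "Suc j" n] by (simp add: funpow_swap1)
    qed
  qed
  have eq: "bdiff (\<lambda>n. a n * b n) = (\<lambda>n. bdiff a n * b n + a (Suc n) * bdiff b n)"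
    by (auto simp: bdiff_def algebra_simps)
  have *: "cm_upto k (\<lambda>n. bdiff a n * b n)" "cm_upto k (\<lambda>n. a (Suc n) * bdiff b n)"
    using Suc.IH[OF up(2)[OF Suc.prems(1)] up(1)[OF Suc.prems(2)]]
      Suc.IH[OF up(3)[OF Suc.prems(1)] up(2)[OF Suc.prems(2)]] by simp_all
  show ?case
    unfolding cm_upto_def
  proof (intro allI impI)
    fix j n assume j: "j \<le> Suc k"
    show "0 \<le> (bdiff ^^ j) (\<lambda>n. a n * b n) n"
    proof (cases j)
      case 0
      then show ?thesis
        using Suc.prems[unfolded cm_upto_def, rule_format, of 0 n] by simp
    next
      case (Suc i)
      then have "(bdiff ^^ j) (\<lambda>n. a n * b n) n = (bdiff ^^ i) (bdiff (\<lambda>n. a n * b n)) n"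
        by (simp add: funpow_swap1)
      then show ?thesis
        using j Suc *[unfolded cm_upto_def, rule_format, of i n]
        by (simp add: eq bdiff_funpow_add)
    qed
  qed
qed

section \<open>Closure properties of completely monotone sequences\<close>

lemma cm_mult: "cm a \<Longrightarrow> cm b \<Longrightarrow> cm (\<lambda>n. a n * b n)"
  by (simp add: cm_iff_cm_upto cm_upto_mult)

lemma cm_add: "cm a \<Longrightarrow> cm b \<Longrightarrow> cm (\<lambda>n. a n + b n)"
  by (simp add: cm_def bdiff_funpow_add)

lemma cm_cmult: "0 \<le> c \<Longrightarrow> cm a \<Longrightarrow> cm (\<lambda>n. c * a n)"
  by (simp add: cm_def bdiff_funpow_cmult)

lemma cm_const:
  assumes "0 \<le> c"
  shows "cm (\<lambda>n. c)"
proof -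
  have "(bdiff ^^ Suc k) (\<lambda>n. c) = (\<lambda>n. 0)" for k
    by (induction k) (auto simp: bdiff_def)
  then have "(bdiff ^^ k) (\<lambda>n. c) n \<ge> 0" for k n
    using assms by (cases k) auto
  then show ?thesis by (simp add: cm_def)
qed

lemma cm_sum: "(\<And>i. i \<in> I \<Longrightarrow> cm (a i)) \<Longrightarrow> cm (\<lambda>n. \<Sum>i\<in>I. a i n)"
  by (induction I rule: infinite_finite_induct) (auto intro: cm_const cm_add)

lemma cm_power: "cm a \<Longrightarrow> cm (\<lambda>n. a n ^ m)"
  by (induction m) (auto intro: cm_const cm_mult)

lemma cm_tendsto:
  assumes "\<And>N. cm (f N)" "\<And>n. (\<lambda>N. f N n) \<longlonglongrightarrow> a n"
  shows "cm a"
  unfolding cm_def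
proof (intro allI)
  fix k n
  show "0 \<le> (bdiff ^^ k) a n"
    using assms(1) by (intro tendsto_lowerbound[OF bdiff_funpow_tendsto[OF assms(2)]]) (auto simp: cm_def)
qed

lemma cm_has_integral:
  fixes f :: "real \<Rightarrow> nat \<Rightarrow> real"
  assumes "\<And>t. t \<in> S \<Longrightarrow> cm (f t)" "\<And>n. ((\<lambda>t. f t n) has_integral a n) S"
  shows "cm a"
  unfolding cm_def
proof (intro allI)
  fix k n
  show "0 \<le> (bdiff ^^ k) a n"
    using assms(1) by (intro has_integral_nonneg[OF bdiff_funpow_has_integral[OF assms(2)]]) (auto simp: cm_def)
qed

text \<open>The partial sums of the exponential series are polynomials in \<open>a n\<close> with
  nonnegative coefficients.\<close>

lemma cm_exp:
  assumes "cm a"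
  shows "cm (\<lambda>n. exp (a n))"
proof (rule cm_tendsto)
  show "cm (\<lambda>n. \<Sum>i<N. inverse (fact i) * a n ^ i)" for N
    by (intro cm_sum cm_cmult cm_power assms) auto
  show "(\<lambda>N. \<Sum>i<N. inverse (fact i) * a n ^ i) \<longlonglongrightarrow> exp (a n)" for n
    using exp_converges[of "a n"] by (simp add: sums_def)
qed

text \<open>The difference of \<open>a\<close> is \<open>v\<close> times the product of \<open>a\<close> with its shift, so nonnegativity of
  the differences up to order \<open>k\<close> propagates to order \<open>k + 1\<close>.\<close>
lemma cm_inverse_affine:
  assumes "0 \<le> v" "0 < w"
  shows "cm (\<lambda>n. 1 / (v * real n + w))"
proof -
  have pos: "v * real n + w > 0" for n
    using assms by (intro add_nonneg_pos) auto
  have "cm_upto k (\<lambda>n. 1 / (v * real n + w))" (is "cm_upto k ?a") for k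
  proof (induction k)
    case 0
    then show ?case using pos by (simp add: cm_upto_def less_imp_le)
  next
    case (Suc k)
    have eq: "bdiff ?a = (\<lambda>n. v * (?a n * ?a (Suc n)))"
    proof
      fix n show "bdiff ?a n = v * (?a n * ?a (Suc n))"
        using pos[of n] pos[of "Suc n"] by (simp add: bdiff_def field_simps)
    qed
    have prod: "cm_upto k (\<lambda>n. ?a n * ?a (Suc n))"
    proof (rule cm_upto_mult[OF Suc])
      show "cm_upto k (\<lambda>n. ?a (Suc n))"
        using Suc by (simp add: cm_upto_def bdiff_funpow_shift[of _ ?a] del: of_nat_Suc)
    qed
    show ?case
      unfolding cm_upto_def
    proof (intro allI impI)
      fix j n assume j: "j \<le> Suc k"
      show "0 \<le> (bdiff ^^ j) ?a n"
      proof (cases j)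
        case 0
        then show ?thesis using pos[of n] by simp
      next
        case (Suc i)
        then have "(bdiff ^^ j) ?a n = (bdiff ^^ i) (bdiff ?a) n"
          by (simp add: funpow_swap1)
        also have "\<dots> = v * (bdiff ^^ i) (\<lambda>n. ?a n * ?a (Suc n)) n"
          by (simp only: eq bdiff_funpow_cmult)
        also have "\<dots> \<ge> 0"
          using prod j Suc assms by (intro mult_nonneg_nonneg) (auto simp: cm_upto_def)
        finally show ?thesis .
      qed
    qed
  qed
  then show ?thesis by (simp add: cm_iff_cm_upto)
qed

subsection \<open>Hausdorff's moment theorem\<close>

text \<open>With the shift S one has \<open>bdiff\<close> = 1 - S, and the sum is the binomial
  expansion of ((1 - S) + S)^M = 1 applied to \<open>a\<close> at \<open>m\<close>.\<close>

lemma sum_binomial_bdiff: "(\<Sum>i\<le>M. real (M choose i) * (bdiff ^^ (M - i)) a (m + i)) = a m"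
proof (induction M arbitrary: a m)
  case 0
  then show ?case by simp
next
  case (Suc M)
  let ?D = "\<lambda>j n. (bdiff ^^ j) a n"
  have "a m = bdiff a m + a (Suc m)"
    by (simp add: bdiff_def)
  also have "bdiff a m = (\<Sum>i\<le>M. real (M choose i) * ?D (Suc M - i) (m + i))"
    by (subst Suc.IH[symmetric], rule sum.cong) (auto simp: Suc_diff_le funpow_swap1)
  \<comment> \<open>The added term has coefficient \<open>M choose Suc M\<close> = 0. After
    splitting off index 0, Pascal's rule merges this sum with the one for
    \<open>a (Suc m)\<close>.\<close>
  also have "\<dots> = (\<Sum>i\<le>Suc M. real (M choose i) * ?D (Suc M - i) (m + i))"
    by simp
  also have "\<dots> = ?D (Suc M) m + (\<Sum>i\<le>M. real (M choose Suc i) * ?D (M - i) (m + Suc i))"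
    by (subst sum.atMost_Suc_shift) simp
  also have "a (Suc m) = (\<Sum>i\<le>M. real (M choose i) * ?D (M - i) (m + Suc i))"
    by (subst Suc.IH[symmetric]) simp
  finally show ?case
    by (subst sum.atMost_Suc_shift) (simp add: sum.distrib algebra_simps)
qed

text \<open>If \<open>a\<close> is the moment sequence of \<open>\<sigma>\<close>, this is the \<open>\<sigma>\<close>-integral of the \<open>j\<close>-th Bernstein
  polynomial of degree \<open>N\<close>; placed at \<open>j / N\<close>, the weights approximate \<open>\<sigma>\<close>.\<close>
definition bernstein_weight :: "(nat \<Rightarrow> real) \<Rightarrow> nat \<Rightarrow> nat \<Rightarrow> real" where
  "bernstein_weight a N j = real (N choose j) * (bdiff ^^ (N - j)) a j"

lemma bernstein_weight_nonneg: "cm a \<Longrightarrow> 0 \<le> bernstein_weight a N j"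
  by (simp add: bernstein_weight_def cm_def)

lemma sum_bernstein_weight: "(\<Sum>j\<le>N. bernstein_weight a N j) = a 0"
  using sum_binomial_bdiff[where m = 0] by (simp add: bernstein_weight_def)

text \<open>Exact counterpart of expanding x^m in Bernstein polynomials of degree \<open>N\<close>,
  where the coefficients are these binomial ratios instead of (j/N)^m.\<close>

lemma sum_bernstein_weight_binomial:
  assumes "m \<le> N"
  shows "(\<Sum>j\<le>N. bernstein_weight a N j * (real (j choose m) / real (N choose m))) = a m"
proof -
  have "(\<Sum>j\<le>N. bernstein_weight a N j * (real (j choose m) / real (N choose m))) =
        (\<Sum>j\<in>{m..N}. bernstein_weight a N j * (real (j choose m) / real (N choose m)))"
    by (intro sum.mono_neutral_right) auto
  also have "\<dots> = (\<Sum>j\<in>{m..N}. real ((N - m) choose (j - m)) * (bdiff ^^ (N - j)) a j)"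
  proof (rule sum.cong)
    fix j assume "j \<in> {m..N}"
    then have j: "m \<le> j" "j \<le> N" by auto
    then have "real (N choose j) * real (j choose m) = real (N choose m) * real ((N - m) choose (j - m))"
      by (metis choose_mult of_nat_mult)
    moreover have "real (N choose m) > 0" using assms by simp
    ultimately show "bernstein_weight a N j * (real (j choose m) / real (N choose m)) =
        real ((N - m) choose (j - m)) * (bdiff ^^ (N - j)) a j"
      by (simp add: bernstein_weight_def field_simps)
  qed simp
  also have "\<dots> = (\<Sum>i\<le>N - m. real ((N - m) choose i) * (bdiff ^^ (N - m - i)) a (m + i))"
    by (rule sum.reindex_bij_witness[of _ "\<lambda>i. m + i" "\<lambda>j. j - m"]) (use assms in auto)
  also have "\<dots> = a m" by (rule sum_binomial_bdiff)
  finally show ?thesis .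
qed

text \<open>Both quantities are products of \<open>m\<close> factors of absolute value at most 1, so
  they differ by at most the sum of the differences of the factors.\<close>

lemma binomial_ratio_approx:
  assumes "2 * m < N" "j \<le> N"
  shows "\<bar>real (j choose m) / real (N choose m) - (real j / real N) ^ m\<bar> \<le> real m * (real m / (real N - real m))"
proof -
  have "real (j choose m) / real (N choose m) = (\<Prod>i<m. (real j - real i)) / (\<Prod>i<m. (real N - real i))"
    by (simp add: binomial_gbinomial gbinomial_prod_rev atLeast0LessThan)
  also have "\<dots> = (\<Prod>i<m. (real j - real i) / (real N - real i))"
    by (simp add: prod_dividef)
  finally have eq: "real (j choose m) / real (N choose m) = \<dots>" .
  have "\<bar>(\<Prod>i<m. (real j - real i) / (real N - real i)) - (\<Prod>i<m. real j / real N)\<bar>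
      \<le> (\<Sum>i<m. \<bar>(real j - real i) / (real N - real i) - real j / real N\<bar>)"
  proof (rule norm_prod_diff[where 'a = real, unfolded real_norm_def])
    \<comment> \<open>The numerator \<open>j - i\<close> is negative for \<open>j < i\<close>; there
      \<open>2 * m < N\<close> keeps the quotient above -1.\<close>
    fix i assume "i \<in> {..<m}"
    then show "\<bar>(real j - real i) / (real N - real i)\<bar> \<le> 1" "\<bar>real j / real N\<bar> \<le> 1"
      using assms by (auto simp: abs_if field_simps)
  qed
  also have "\<dots> \<le> (\<Sum>i<m. real m / (real N - real m))"
  proof (rule sum_mono)
    fix i assume "i \<in> {..<m}"
    then have i: "i < m" by simp
    then have "(real j - real i) / (real N - real i) - real j / real N
        = - ((real i / (real N - real i)) * ((real N - real j) / real N))"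
      using assms by (simp add: field_simps)
    also have "\<bar>\<dots>\<bar> = (real i / (real N - real i)) * ((real N - real j) / real N)"
      using assms i by (simp add: abs_mult)
    also have "\<dots> \<le> (real m / (real N - real m)) * 1"
      using assms i by (intro mult_mono frac_le) (auto simp: field_simps)
    finally show "\<bar>(real j - real i) / (real N - real i) - real j / real N\<bar> \<le> real m / (real N - real m)"
      by simp
  qed
  finally show ?thesis by (simp add: eq)
qed

text \<open>Subtracting the exact binomial identity leaves an error of order 1/N, averaged against
  nonnegative weights of total mass \<open>a 0\<close>.\<close>

lemma bernstein_moments_tendsto:
  assumes "cm a"
  shows "(\<lambda>N. \<Sum>j\<le>N. bernstein_weight a N j * (real j / real N) ^ m) \<longlonglongrightarrow> a m"
proof (rule LIM_zero_cancel, rule Lim_null_comparison)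
  show "\<forall>\<^sub>F N in sequentially. norm ((\<Sum>j\<le>N. bernstein_weight a N j * (real j / real N) ^ m) - a m)
     \<le> a 0 * (real m * (real m / (real N - real m)))"
    using eventually_gt_at_top[of "2 * m"]
  proof eventually_elim
    case (elim N)
    have "(\<Sum>j\<le>N. bernstein_weight a N j * (real j / real N) ^ m) - a m =
        (\<Sum>j\<le>N. bernstein_weight a N j * ((real j / real N) ^ m - real (j choose m) / real (N choose m)))"
      using sum_bernstein_weight_binomial[of m N a] elim by (simp add: sum_subtractf algebra_simps)
    also have "norm \<dots> \<le> (\<Sum>j\<le>N. bernstein_weight a N j * (real m * (real m / (real N - real m))))"
    proof (rule sum_norm_le)
      fix j assume "j \<in> {..N}"
      then show "norm (bernstein_weight a N j * ((real j / real N) ^ m - real (j choose m) / real (N choose m)))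
          \<le> bernstein_weight a N j * (real m * (real m / (real N - real m)))"
        using mult_left_mono[OF binomial_ratio_approx[of m N j] bernstein_weight_nonneg[OF assms, of N j]]
          elim bernstein_weight_nonneg[OF assms, of N j]
        by (simp add: abs_mult abs_minus_commute)
    qed
    also have "\<dots> = a 0 * (real m * (real m / (real N - real m)))"
      by (simp only: sum_distrib_right[symmetric] sum_bernstein_weight)
    finally show ?case .
  qed
  show "(\<lambda>N. a 0 * (real m * (real m / (real N - real m)))) \<longlonglongrightarrow> 0"
    by real_asymp
qed

text \<open>The Bernstein weights, normalised by \<open>a 0\<close> and placed at
  \<open>j / N\<close>, form a tight family of probability measures. Helly selection yields a weak
  limit, whose moments are limits of the approximate moments.\<close>

theorem cm_imp_hausdorff_moment_sequence:
  assumes cm: "cm a" and pos: "\<And>n. 0 < a n"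
  shows "hausdorff_moment_sequence a"
proof -
  let ?w = "\<lambda>N j. if j \<le> N then bernstein_weight a N j / a 0 else 0"
  define p where "p N = embed_pmf (?w N)" for N
  have pmf: "pmf (p N) j = ?w N j" for N j
    unfolding p_def
  proof (rule pmf_embed_pmf)
    show w: "0 \<le> ?w N j" for j
      using bernstein_weight_nonneg[OF cm] pos[of 0] by simp
    have "(\<integral>\<^sup>+ j. ennreal (?w N j) \<partial>count_space UNIV) = (\<Sum>j\<le>N. ennreal (?w N j))"
      by (rule nn_integral_count_space') auto
    also have "\<dots> = ennreal (\<Sum>j\<le>N. ?w N j)"
      using w by (rule sum_ennreal)
    also have "(\<Sum>j\<le>N. ?w N j) = 1"
      using pos[of 0] by (simp add: sum_divide_distrib[symmetric] sum_bernstein_weight)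
    finally show "(\<integral>\<^sup>+ j. ennreal (?w N j) \<partial>count_space UNIV) = 1" by simp
  qed
  \<comment> \<open>For \<open>N = 0\<close> division by zero gives 0, so the only atom still lies
    in the unit interval.\<close>
  define \<mu> where "\<mu> N = distr (measure_pmf (p N)) borel (\<lambda>j. real j / real N)" for N
  have rd: "real_distribution (\<mu> N)" for N
    unfolding \<mu>_def by (intro prob_space.real_distribution_distr) (auto intro: measure_pmf.prob_space_axioms)
  have supp: "set_pmf (p N) \<subseteq> {..N}" for N
    by (auto simp: set_pmf_eq pmf split: if_splits)
  have "tight \<mu>"
    unfolding tight_def
  proof (intro conjI allI impI rd)
    fix \<epsilon> :: real assume "0 < \<epsilon>"
    \<comment> \<open>Tightness uses intervals open on the left, hence the endpoint -1 to capture an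
      atom at 0.\<close>
    have "measure (\<mu> N) {-1<..1} = 1" for N
    proof -
      have "measure (\<mu> N) {-1<..1} = measure (measure_pmf (p N)) ((\<lambda>j. real j / real N) -` {-1<..1})"
        unfolding \<mu>_def by (subst measure_distr) auto
      also have "\<dots> = 1"
      proof (subst measure_pmf.prob_eq_1)
        show "AE j in measure_pmf (p N). j \<in> (\<lambda>j. real j / real N) -` {-1<..1}"
        proof (rule AE_pmfI)
          fix j assume "j \<in> set_pmf (p N)"
          then have "j \<le> N" using supp by blast
          moreover have "-1 < real j / real N" by (rule less_le_trans[of _ 0]) auto
          ultimately show "j \<in> (\<lambda>j. real j / real N) -` {-1<..1}"
            by (cases "N = 0") (auto simp: field_simps)
        qed
      qed auto
      finally show ?thesis .
    qed
    then show "\<exists>x y. x < y \<and> (\<forall>N. 1 - \<epsilon> < measure (\<mu> N) {x<..y})"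
      using \<open>0 < \<epsilon>\<close> by (intro exI[of _ "-1"] exI[of _ 1]) simp
  qed
  from tight_imp_convergent_subsubsequence[OF this strict_mono_id]
  obtain r M where r: "strict_mono r" and M: "real_distribution M" and conv: "weak_conv_m (\<mu> \<circ> r) M"
    by (auto simp: o_def id_def)
  interpret M: real_distribution M by (rule M)
  txt \<open>Pushing the limit forward along \<open>clip\<close> avoids proving that it lives on \<open>{0..1}\<close>.\<close>
  define clip :: "real \<Rightarrow> real" where "clip x = max 0 (min 1 x)" for x
  have clip: "0 \<le> clip x" "clip x \<le> 1" for x by (auto simp: clip_def)
  have [measurable]: "clip \<in> borel_measurable borel" by (simp add: clip_def[abs_def])
  have moment: "(LINT x|M. clip x ^ m) = a m / a 0" for m
  proof (rule LIMSEQ_unique)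
    show "(\<lambda>N. LINT x|(\<mu> \<circ> r) N. clip x ^ m) \<longlonglongrightarrow> (LINT x|M. clip x ^ m)"
    proof (rule weak_conv_imp_integral_bdd_continuous_conv)
      show "real_distribution ((\<mu> \<circ> r) N)" for N using rd by simp
      show "isCont (\<lambda>x. clip x ^ m) x" for x
        unfolding clip_def by (intro continuous_intros)
      show "norm (clip x ^ m) \<le> 1" for x
        using clip[of x] by (simp add: power_le_one)
    qed (fact M conv)+
    have "(LINT x|\<mu> N. clip x ^ m) = (\<Sum>j\<le>N. bernstein_weight a N j * (real j / real N) ^ m) / a 0" for N
    proof -
      have "(LINT x|\<mu> N. clip x ^ m) = (LINT j|measure_pmf (p N). clip (real j / real N) ^ m)"
        unfolding \<mu>_def by (subst integral_distr) auto
      also have "\<dots> = (\<Sum>j\<le>N. clip (real j / real N) ^ m * pmf (p N) j)"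
        using supp by (intro integral_measure_pmf_real) auto
      also have "\<dots> = (\<Sum>j\<le>N. bernstein_weight a N j * (real j / real N) ^ m / a 0)"
      proof (rule sum.cong)
        fix j assume "j \<in> {..N}"
        then have "real j / real N \<le> 1" by (cases "N = 0") auto
        then have "clip (real j / real N) = real j / real N"
          by (simp add: clip_def)
        then show "clip (real j / real N) ^ m * pmf (p N) j = bernstein_weight a N j * (real j / real N) ^ m / a 0"
          using \<open>j \<in> {..N}\<close> by (simp add: pmf)
      qed simp
      finally show ?thesis by (simp add: sum_divide_distrib)
    qed
    then show "(\<lambda>N. LINT x|(\<mu> \<circ> r) N. clip x ^ m) \<longlonglongrightarrow> a m / a 0"
      using LIMSEQ_subseq_LIMSEQ[OF bernstein_moments_tendsto[OF cm] r] pos[of 0]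
      by (auto simp: o_def intro!: tendsto_divide)
  qed
  \<comment> \<open>The constant density restores the total mass \<open>a 0\<close>.\<close>
  define \<sigma> where "\<sigma> = density (distr M (restrict_space borel {0..1}) clip) (\<lambda>_. ennreal (a 0))"
  have [measurable]: "clip \<in> measurable M (restrict_space borel {0..1})"
    by (rule measurable_restrict_space2) (use clip in auto)
  have [measurable]: "(\<lambda>x::real. x ^ m) \<in> borel_measurable (restrict_space borel {0..1})" for m :: nat
    by (rule measurable_restrict_space1) simp
  have int: "integrable M (\<lambda>x. clip x ^ m)" for m
    using clip by (intro M.integrable_const_bound[where B = 1]) (auto simp: power_le_one)
  have "has_bochner_integral \<sigma> (\<lambda>x. x ^ m) (a m)" for m
  proof -
    have "has_bochner_integral (distr M (restrict_space borel {0..1}) clip) (\<lambda>x. a 0 *\<^sub>R x ^ m) (a m)"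
    proof (subst has_bochner_integral_distr)
      show "has_bochner_integral M (\<lambda>x. a 0 *\<^sub>R clip x ^ m) (a m)"
        using int[of m] moment[of m] pos[of 0] by (simp add: has_bochner_integral_iff)
    qed auto
    then show ?thesis
      unfolding \<sigma>_def using pos[of 0] by (intro has_bochner_integral_density) auto
  qed
  moreover have "sets \<sigma> = sets (restrict_space borel {0..1})"
    by (simp add: \<sigma>_def)
  ultimately show ?thesis
    using pos unfolding hausdorff_moment_sequence_def by blast
qed

subsection \<open>Powers and reciprocal logarithms\<close>

text \<open>The logarithm is the integral of 1 / (y + t) over t in \<open>{0..N}\<close>, with y =
  \<open>v * real n + w\<close>.\<close>

lemma cm_ln:
  assumes "0 \<le> v" "0 < w" "0 \<le> N"
  shows "cm (\<lambda>n. ln ((v * real n + w + N) / (v * real n + w)))"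
proof (rule cm_has_integral)
  show "cm (\<lambda>n. 1 / (v * real n + (w + t)))" if "t \<in> {0..N}" for t
    using assms that by (intro cm_inverse_affine) auto
  fix n
  define y where "y = v * real n + w"
  have y: "y > 0" using assms by (auto simp: y_def intro: add_nonneg_pos)
  have "((\<lambda>t. 1 / (y + t)) has_integral (ln (y + N) - ln (y + 0))) {0..N}"
    by (rule fundamental_theorem_of_calculus)
       (use y assms in \<open>auto intro!: derivative_eq_intros simp flip: has_real_derivative_iff_has_vector_derivative\<close>)
  then show "((\<lambda>t. 1 / (v * real n + (w + t))) has_integral
      ln ((v * real n + w + N) / (v * real n + w))) {0..N}"
    using y assms unfolding y_def[symmetric] by (simp add: ln_div y_def add.assoc)
qed

text \<open>\<open>y powr (- r)\<close> is the limit of the normalised exponentials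
  \<open>exp (r * ln ((y + N) / y)) / N powr r\<close>.\<close>
lemma cm_powr:
  assumes "0 \<le> v" "0 < w" "0 \<le> r"
  shows "cm (\<lambda>n. (v * real n + w) powr (- r))"
proof (rule cm_tendsto)
  let ?f = "\<lambda>N n. real (Suc N) powr (- r) * exp (r * ln ((v * real n + w + real (Suc N)) / (v * real n + w)))"
  show "cm (?f N)" for N
    using assms by (intro cm_cmult cm_exp cm_ln) auto
  fix n
  define y where "y = v * real n + w"
  have y: "y > 0" using assms by (auto simp: y_def intro: add_nonneg_pos)
  have "(\<lambda>N. ((y / real (Suc N) + 1) / y) powr r) \<longlonglongrightarrow> ((0 + 1) / y) powr r"
  proof (intro tendsto_intros)
    show "(\<lambda>N. y / real (Suc N)) \<longlonglongrightarrow> 0" by real_asymp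
  qed (use y in auto)
  also have "((0 + 1) / y) powr r = y powr (- r)"
    using y by (simp add: powr_minus_divide powr_divide)
  also have "(\<lambda>N. ((y / real (Suc N) + 1) / y) powr r) = (\<lambda>N. ?f N n)"
  proof
    fix N
    have "(y / real (Suc N) + 1) / y = ((y + real (Suc N)) / y) / real (Suc N)"
      using y by (simp add: field_simps)
    also have "\<dots> powr r = ((y + real (Suc N)) / y) powr r / real (Suc N) powr r"
      by (rule powr_divide)
    also have "((y + real (Suc N)) / y) powr r = exp (r * ln ((y + real (Suc N)) / y))"
      using y by (simp add: powr_def add_pos_nonneg)
    finally show "((y / real (Suc N) + 1) / y) powr r = ?f N n"
      by (simp add: y_def powr_minus divide_inverse)
  qed
  finally show "(\<lambda>N. ?f N n) \<longlonglongrightarrow> (v * real n + w) powr (- r)"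
    by (simp add: y_def)
qed

text \<open>With m = n + 1, the quotient ((1 + m)^s - 1) / m is the integral of s (1 + m t)^(s - 1)
  over t in \<open>{0..1}\<close>; the base is affine in n and the exponent is not positive.\<close>

lemma cm_powr_quotient:
  assumes "0 \<le> s" "s \<le> 1"
  shows "cm (\<lambda>n. ((real n + 2) powr s - 1) / (real n + 1))"
proof (rule cm_has_integral)
  show "cm (\<lambda>n. s * (t * real n + (1 + t)) powr (- (1 - s)))" if "t \<in> {0..1}" for t
    using assms that by (intro cm_cmult cm_powr) auto
  fix n
  let ?m = "real n + 1"
  have "((\<lambda>t. s * (1 + ?m * t) powr (s - 1)) has_integral
      ((1 + ?m * 1) powr s / ?m - (1 + ?m * 0) powr s / ?m)) {0..1}"
  proof (rule fundamental_theorem_of_calculus)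
    fix t :: real assume "t \<in> {0..1}"
    then have "1 + ?m * t > 0" by (intro add_pos_nonneg) auto
    then have "((\<lambda>t. (1 + ?m * t) powr s / ?m) has_real_derivative
        s * (1 + ?m * t) powr (s - 1)) (at t within {0..1})"
      by (auto intro!: derivative_eq_intros)
    then show "((\<lambda>t. (1 + ?m * t) powr s / ?m) has_vector_derivative
        s * (1 + ?m * t) powr (s - 1)) (at t within {0..1})"
      by (simp add: has_real_derivative_iff_has_vector_derivative)
  qed simp
  then show "((\<lambda>t. s * (t * real n + (1 + t)) powr (- (1 - s))) has_integral
      ((real n + 2) powr s - 1) / ?m) {0..1}"
    by (simp add: algebra_simps diff_divide_distrib)
qed

lemma powr_has_integral:
  fixes x c :: real
  assumes "1 < x" "c \<noteq> 0"
  shows "((\<lambda>s. x powr (c * s)) has_integral (x powr c - 1) / (c * ln x)) {0..1}"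
proof -
  have "((\<lambda>s. x powr (c * s)) has_integral (x powr (c * 1) / (c * ln x) - x powr (c * 0) / (c * ln x))) {0..1}"
  proof (rule fundamental_theorem_of_calculus)
    fix s :: real
    have "((\<lambda>s. x powr (c * s) / (c * ln x)) has_real_derivative x powr (c * s)) (at s within {0..1})"
      using assms by (auto intro!: derivative_eq_intros simp: powr_def)
    then show "((\<lambda>s. x powr (c * s) / (c * ln x)) has_vector_derivative x powr (c * s)) (at s within {0..1})"
      by (simp add: has_real_derivative_iff_has_vector_derivative)
  qed simp
  then show ?thesis using assms by (simp add: diff_divide_distrib)
qed

lemma cm_inverse_ln_minus:
  "cm (\<lambda>n. 1 / ln (real n + 2) - 1 / (real n + 1))"
proof (rule cm_has_integral)
  show "cm (\<lambda>n. ((real n + 2) powr s - 1) / (real n + 1))" if "s \<in> {0..1}" for s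
    using that by (intro cm_powr_quotient) auto
  fix n
  have "((\<lambda>s. (real n + 2) powr (1 * s)) has_integral ((real n + 2) powr 1 - 1) / (1 * ln (real n + 2))) {0..1}"
    by (rule powr_has_integral) auto
  from has_integral_divide[OF has_integral_diff[OF this has_integral_const_real[of 1 0 1]], of "real n + 1"]
  have "((\<lambda>s. ((real n + 2) powr s - 1) / (real n + 1)) has_integral
      (((real n + 2) powr 1 - 1) / ln (real n + 2) - 1) / (real n + 1)) {0..1}"
    by simp
  also have "(((real n + 2) powr 1 - 1) / ln (real n + 2) - 1) / (real n + 1) =
      1 / ln (real n + 2) - 1 / (real n + 1)"
  proof -
    have "ln (real n + 2) > 0" by simp
    then show ?thesis by (simp add: field_simps)
  qed
  finally show "((\<lambda>s. ((real n + 2) powr s - 1) / (real n + 1)) has_integral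
      1 / ln (real n + 2) - 1 / (real n + 1)) {0..1}" .
qed

lemma cm_inverse_ln: "cm (\<lambda>n. 1 / ln (real n + 2))"
  using cm_add[OF cm_inverse_ln_minus cm_inverse_affine[of 1 1]] by simp

text \<open>Passing from x - 1 to x in the denominator adds 1/(x - 1) - 1/x, a product of two
  reciprocals.\<close>

lemma cm_inverse_ln_minus': "cm (\<lambda>n. 1 / ln (real n + 2) - 1 / (real n + 2))"
proof -
  have "cm (\<lambda>n. 1 / (1 * real n + 1) * (1 / (1 * real n + 2)))"
    by (intro cm_mult cm_inverse_affine) auto
  also have "(\<lambda>n. 1 / (1 * real n + 1) * (1 / (1 * real n + 2))) = (\<lambda>n. 1 / (real n + 1) - 1 / (real n + 2))"
    by (auto simp: field_simps)
  finally show ?thesis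
    using cm_add[OF cm_inverse_ln_minus] by force
qed

lemma cm_inverse_ln_mult:
  "cm (\<lambda>n. (1 - 1 / (real n + 2)) * (1 / ln (real n + 2)))"
proof (rule cm_has_integral)
  show "cm (\<lambda>n. (1 * real n + 2) powr (- s))" if "s \<in> {0..1}" for s
    using that by (intro cm_powr) auto
  fix n
  have "((\<lambda>s. (real n + 2) powr (-1 * s)) has_integral ((real n + 2) powr (-1) - 1) / (-1 * ln (real n + 2))) {0..1}"
    by (rule powr_has_integral) auto
  also have "((real n + 2) powr (-1) - 1) / (-1 * ln (real n + 2)) = (1 - 1 / (real n + 2)) * (1 / ln (real n + 2))"
    by (simp add: powr_minus_divide minus_divide_right[symmetric] diff_divide_distrib)
  finally show "((\<lambda>s. (1 * real n + 2) powr (- s)) has_integral (1 - 1 / (real n + 2)) * (1 / ln (real n + 2))) {0..1}"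
    by simp
qed

subsection \<open>The remainder in Stirling's formula\<close>

text \<open>With \<open>\<theta> z = (z + 1 / 2) * ln (1 + 1 / z) - 1\<close>, the Binet function is the sum of the
  \<open>\<theta> (z + k)\<close>, and \<open>\<theta>\<close> is the integral of \<open>v * (1 - v) / 2 / (z + v)\<^sup>2\<close> over \<open>{0..1}\<close>.
  Subtracting \<open>\<theta>\<close> from the integral of \<open>1 / 8 / (z + v)\<^sup>2\<close> leaves the square kernel
  \<open>(v - 1 / 2)\<^sup>2 / 2\<close>.\<close>
definition stirling_step :: "real \<Rightarrow> real" where
  "stirling_step z = 1 / (8 * z * (z + 1)) - (z + 1 / 2) * (ln (z + 1) - ln z) + 1"

lemma stirling_step_has_integral:
  assumes "0 < z"
  shows "((\<lambda>v. (v - 1 / 2)\<^sup>2 / 2 * (1 / (z + v) * (1 / (z + v)))) has_integral stirling_step z) {0..1}"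
proof -
  \<comment> \<open>About the midpoint \<open>b\<close> the kernel's numerator is ((z + v) - b)^2,
    so dividing by (z + v)^2 leaves three elementary integrands.\<close>
  define b where "b = z + 1 / 2"
  define F where "F v = ((z + v) - 2 * b * ln (z + v) - b\<^sup>2 / (z + v)) / 2" for v
  have "((\<lambda>v. (v - 1 / 2)\<^sup>2 / 2 * (1 / (z + v) * (1 / (z + v)))) has_integral (F 1 - F 0)) {0..1}"
  proof (rule fundamental_theorem_of_calculus)
    fix v :: real assume "v \<in> {0..1}"
    then have pos: "z + v > 0" using assms by simp
    have "(F has_real_derivative (1 - 2 * b / (z + v) + b\<^sup>2 / (z + v)\<^sup>2) / 2) (at v within {0..1})"
      unfolding F_def using pos
      by (auto intro!: derivative_eq_intros simp: power2_eq_square)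
    also have "(1 - 2 * b / (z + v) + b\<^sup>2 / (z + v)\<^sup>2) / 2 = ((z + v) - b)\<^sup>2 / 2 * (1 / (z + v) * (1 / (z + v)))"
      using pos by (simp add: divide_simps power2_eq_square) (simp add: algebra_simps)
    finally show "(F has_vector_derivative (v - 1 / 2)\<^sup>2 / 2 * (1 / (z + v) * (1 / (z + v)))) (at v within {0..1})"
      by (simp add: has_real_derivative_iff_has_vector_derivative b_def)
  qed simp
  also have "F 1 - F 0 = 1 / 2 - b * (ln (z + 1) - ln z) + b\<^sup>2 * (1 / z - 1 / (z + 1)) / 2"
    by (simp add: F_def algebra_simps add_divide_distrib diff_divide_distrib)
  \<comment> \<open>Here b^2 = z (z + 1) + 1/4.\<close>
  also have "b\<^sup>2 * (1 / z - 1 / (z + 1)) / 2 = 1 / 2 + 1 / (8 * z * (z + 1))"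
    using assms by (simp add: b_def divide_simps power2_eq_square) (simp add: algebra_simps)
  finally show ?thesis
    by (simp add: stirling_step_def b_def algebra_simps)
qed

lemma cm_stirling_step:
  assumes "0 \<le> v" "0 < w"
  shows "cm (\<lambda>n. stirling_step (v * real n + w))"
proof (rule cm_has_integral)
  show "cm (\<lambda>n. (t - 1 / 2)\<^sup>2 / 2 * (1 / (v * real n + (w + t)) * (1 / (v * real n + (w + t)))))"
    if "t \<in> {0..1}" for t
    using assms that by (intro cm_cmult cm_mult cm_inverse_affine) auto
  show "((\<lambda>t. (t - 1 / 2)\<^sup>2 / 2 * (1 / (v * real n + (w + t)) * (1 / (v * real n + (w + t)))))
      has_integral stirling_step (v * real n + w)) {0..1}" for n
    using stirling_step_has_integral[of "v * real n + w"] assms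
    by (simp add: add.assoc add_nonneg_pos)
qed

lemma stirling_step_nonneg: "0 < z \<Longrightarrow> 0 \<le> stirling_step z"
  by (rule has_integral_nonneg[OF stirling_step_has_integral]) auto

text \<open>The bound ln (1 + 1/z) >= 1 / (z + 1/2) removes the logarithm and leaves a term that
  telescopes under z -> z + 1.\<close>

lemma stirling_step_le:
  assumes "0 < z"
  shows "stirling_step z \<le> 1 / (8 * z) - 1 / (8 * (z + 1))"
proof -
  have "1 = (z + 1 / 2) * (2 * ((z + 1) - z) / (z + (z + 1)))"
    using assms by (simp add: field_simps)
  also have "\<dots> \<le> (z + 1 / 2) * (ln (z + 1) - ln z)"
    using assms by (intro mult_left_mono ln_inverse_approx_ge) auto
  finally have "stirling_step z \<le> 1 / (8 * z * (z + 1))"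
    by (simp add: stirling_step_def)
  also have "\<dots> = 1 / (8 * z) - 1 / (8 * (z + 1))"
    using assms by (simp add: field_simps)
  finally show ?thesis .
qed

text \<open>This is L + \<open>R z\<close> in the notation of the introduction; its limit L is
  \<open>stirling_error_lim\<close>.\<close>

definition stirling_error :: "real \<Rightarrow> real" where
  "stirling_error z = (z + 1 / 2) * ln z - z + 1 / (8 * z) - ln (Gamma (1 + z))"

lemma stirling_error_step:
  assumes "0 < z"
  shows "stirling_error z - stirling_error (z + 1) = stirling_step z"
proof -
  have "ln (Gamma (1 + (z + 1))) = ln (z + 1) + ln (Gamma (1 + z))"
    using assms Gamma_plus1[of "1 + z"] by (subst ln_mult_pos[symmetric])
      (auto simp: add_ac nonpos_Ints_def)
  moreover have "1 / (8 * z) - 1 / (8 * (z + 1)) = 1 / (8 * z * (z + 1))"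
    using assms by (simp add: field_simps)
  ultimately show ?thesis
    by (simp add: stirling_error_def stirling_step_def algebra_simps)
qed

lemma stirling_error_shift:
  assumes "0 < z"
  shows "stirling_error z - stirling_error (z + real N) = (\<Sum>k<N. stirling_step (z + real k))"
proof (induction N)
  case (Suc N)
  have "stirling_error (z + real N) - stirling_error (z + real N + 1) = stirling_step (z + real N)"
    using assms by (intro stirling_error_step) auto
  then show ?case using Suc by (simp add: algebra_simps)
qed simp

text \<open>Euler's limit formula: \<open>Gamma z / Gamma_series z N\<close> equals Gamma (1 + z +
  N) / (N! N^z) and tends to 1.\<close>

lemma ln_Gamma_shift_tendsto:
  assumes "0 < z"
  shows "(\<lambda>N. ln (Gamma (1 + (z + real N))) - ln (Gamma (1 + real N)) - z * ln (real N)) \<longlonglongrightarrow> 0"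
proof -
  have z: "z \<notin> \<int>\<^sub>\<le>\<^sub>0" using assms by (auto simp: nonpos_Ints_def)
  have G: "Gamma z > 0" using assms by (rule Gamma_real_pos)
  have "(\<lambda>N. ln (Gamma z) - ln (Gamma_series z N)) \<longlonglongrightarrow> ln (Gamma z) - ln (Gamma z)"
    using G by (intro tendsto_intros Gamma_series_LIMSEQ) auto
  also have "ln (Gamma z) - ln (Gamma z) = 0" by simp
  finally have lim: "(\<lambda>N. ln (Gamma z) - ln (Gamma_series z N)) \<longlonglongrightarrow> 0" .
  show ?thesis
  proof (rule Lim_transform_eventually[OF lim])
    show "\<forall>\<^sub>F N in sequentially. ln (Gamma z) - ln (Gamma_series z N) =
        ln (Gamma (1 + (z + real N))) - ln (Gamma (1 + real N)) - z * ln (real N)"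
      using eventually_gt_at_top[of 0]
    proof eventually_elim
      case (elim N)
      have p: "pochhammer z (N + 1) = Gamma (1 + (z + real N)) / Gamma z"
        using pochhammer_Gamma[OF z, of "N + 1"] by (simp add: add_ac)
      have G': "Gamma (1 + (z + real N)) > 0" using assms by (intro Gamma_real_pos) auto
      have f: "Gamma (1 + real N) = fact N" by (rule Gamma_fact)
      show ?case
        using G G' unfolding Gamma_series_def p f
        by (simp add: ln_div ln_mult)
    qed
  qed
qed

text \<open>Makes the limit of \<open>stirling_error\<close> along z + N independent of z, so that a
  single constant serves all arguments.\<close>

lemma stirling_error_shift_tendsto:
  assumes "0 < z"
  shows "(\<lambda>N. stirling_error (z + real N) - stirling_error (real N)) \<longlonglongrightarrow> 0"
proof -
  have "(\<lambda>N. ((z + real N + 1 / 2) * ln (z + real N) - (real N + 1 / 2) * ln (real N) - z - z * ln (real N)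
      + 1 / (8 * (z + real N)) - 1 / (8 * real N))
      - (ln (Gamma (1 + (z + real N))) - ln (Gamma (1 + real N)) - z * ln (real N))) \<longlonglongrightarrow> 0 - 0"
  proof (intro tendsto_diff[OF _ ln_Gamma_shift_tendsto[OF assms]])
    show "(\<lambda>N. (z + real N + 1 / 2) * ln (z + real N) - (real N + 1 / 2) * ln (real N) - z - z * ln (real N)
      + 1 / (8 * (z + real N)) - 1 / (8 * real N)) \<longlonglongrightarrow> 0"
      using assms by real_asymp
  qed
  then show ?thesis
    by (simp add: stirling_error_def algebra_simps)
qed

lemma stirling_error_bounds:
  assumes "0 < z"
  shows "stirling_error (z + real N) \<le> stirling_error z"
    and "stirling_error z \<le> stirling_error (z + real N) + 1 / (8 * z)"
proof -
  have "0 \<le> (\<Sum>k<N. stirling_step (z + real k))"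
    using assms by (intro sum_nonneg stirling_step_nonneg) auto
  then show "stirling_error (z + real N) \<le> stirling_error z"
    by (simp flip: stirling_error_shift[OF assms])
  have "(\<Sum>k<N. stirling_step (z + real k)) \<le>
      (\<Sum>k<N. 1 / (8 * (z + real k)) - 1 / (8 * (z + real (Suc k))))"
    using assms stirling_step_le[of "z + real k" for k] by (intro sum_mono) (simp add: add_ac)
  also have "\<dots> = 1 / (8 * z) - 1 / (8 * (z + real N))"
    by (subst sum_lessThan_telescope') simp
  also have "\<dots> \<le> 1 / (8 * z)"
    using assms by simp
  finally show "stirling_error z \<le> stirling_error (z + real N) + 1 / (8 * z)"
    by (simp flip: stirling_error_shift[OF assms])
qed

definition stirling_error_lim :: real where
  "stirling_error_lim = lim (\<lambda>N. stirling_error (real N))"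

lemma stirling_error_tendsto:
  assumes "0 < z"
  shows "(\<lambda>N. stirling_error (z + real N)) \<longlonglongrightarrow> stirling_error_lim"
proof -
  \<comment> \<open>The index starts at 1 because the bounds require a positive argument.\<close>
  have "decseq (\<lambda>N. stirling_error (real (Suc N)))"
    unfolding decseq_Suc_iff
  proof
    fix N show "stirling_error (real (Suc (Suc N))) \<le> stirling_error (real (Suc N))"
      using stirling_error_bounds(1)[of "real (Suc N)" 1] by (simp add: add_ac)
  qed
  moreover have "stirling_error 1 - 1 / 8 \<le> stirling_error (real (Suc N))" for N
    using stirling_error_bounds(2)[of 1 N] by simp
  ultimately obtain L where "(\<lambda>N. stirling_error (real (Suc N))) \<longlonglongrightarrow> L"
    using decseq_convergent by blast
  then have "(\<lambda>N. stirling_error (real N)) \<longlonglongrightarrow> L"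
    by (rule LIMSEQ_imp_Suc)
  then have "(\<lambda>N. stirling_error (real N)) \<longlonglongrightarrow> stirling_error_lim"
    unfolding stirling_error_lim_def by (simp add: limI)
  from tendsto_add[OF stirling_error_shift_tendsto[OF assms] this] show ?thesis
    by simp
qed

lemma stirling_error_lim_le: "0 < z \<Longrightarrow> stirling_error_lim \<le> stirling_error z"
  by (rule tendsto_upperbound[OF stirling_error_tendsto[of z]])
     (auto simp: stirling_error_bounds(1))

lemma stirling_error_le:
  assumes "0 < z"
  shows "stirling_error z \<le> stirling_error_lim + 1 / (8 * z)"
proof -
  have "stirling_error z - 1 / (8 * z) \<le> stirling_error_lim"
  proof (rule tendsto_lowerbound[OF stirling_error_tendsto[OF assms]])
    show "\<forall>\<^sub>F N in sequentially. stirling_error z - 1 / (8 * z) \<le> stirling_error (z + real N)"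
      using stirling_error_bounds(2)[OF assms] by (simp add: diff_le_eq)
  qed simp
  then show ?thesis by simp
qed

text \<open>Telescoping exhibits the remainder as the infinite sum of the
  \<open>stirling_step\<close> terms.\<close>

lemma cm_stirling_error:
  assumes "0 \<le> v" "0 < w"
  shows "cm (\<lambda>n. stirling_error (v * real n + w) - stirling_error_lim)"
proof (rule cm_tendsto)
  show "cm (\<lambda>n. \<Sum>k<N. stirling_step (v * real n + (w + real k)))" for N
    using assms by (intro cm_sum cm_stirling_step) auto
  fix n
  have pos: "v * real n + w > 0" using assms by (intro add_nonneg_pos) auto
  have "(\<lambda>N. stirling_error (v * real n + w) - stirling_error (v * real n + w + real N))
      \<longlonglongrightarrow> stirling_error (v * real n + w) - stirling_error_lim"
    by (intro tendsto_intros stirling_error_tendsto pos)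
  then show "(\<lambda>N. \<Sum>k<N. stirling_step (v * real n + (w + real k)))
      \<longlonglongrightarrow> stirling_error (v * real n + w) - stirling_error_lim"
    by (simp only: stirling_error_shift[OF pos]) (simp only: add.assoc)
qed

section \<open>Signs of the two constant coefficients\<close>

lemma ln_2_le: "ln 2 \<le> (1 :: real)"
  using ln_add_one_self_le_self[of "1 :: real"] by simp

text \<open>Evaluation at z = 1: L <= -7/8, while ln 2 / 2 <= 1/2.\<close>

lemma stirling_error_lim_upper: "stirling_error_lim + ln 2 / 2 \<le> 0"
proof -
  have "Gamma 2 = (1 :: real)"
    using Gamma_fact[of 1, where 'a = real] by simp
  then show ?thesis
    using stirling_error_lim_le[of 1] ln_2_le by (simp add: stirling_error_def)
qed

lemma stirling_error_lim_lower: "0 \<le> ln pi / 2 + ln 2 - 1 / 4 + stirling_error_lim"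
proof -
  have "Gamma 3 = (2 :: real)"
    using Gamma_fact[of 2, where 'a = real] by (simp add: numeral_eq_Suc)
  then have L: "3 / 2 * ln 2 - 2 \<le> stirling_error_lim"
    using stirling_error_le[of 2] by (simp add: stirling_error_def)
  \<comment> \<open>After inserting the bound from z = 2, the claim becomes 9/2 <= ln pi + 5 ln 2.
    As pi > 3, it suffices that exp (9/2) <= 3 * 2^5 = 96.\<close>
  have "exp (9 / 2 :: real) ^ 2 = exp 1 ^ 9"
    by (simp flip: exp_of_nat_mult)
  also have "\<dots> \<le> (272 / 100) ^ 9"
    using e_less_272 by (intro power_mono) auto
  also have "\<dots> \<le> (96 :: real) ^ 2"
    by (simp add: power_divide)
  finally have "exp (9 / 2 :: real) \<le> 96"
    by (rule power2_le_imp_le) simp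
  then have "9 / 2 \<le> ln (96 :: real)"
    by (subst ln_ge_iff) auto
  also have "\<dots> = ln (3 * 2 ^ 5)" by simp
  also have "\<dots> = ln 3 + 5 * ln 2"
    by (subst ln_mult_pos) (simp_all add: ln_realpow del: power_numeral)
  also have "ln 3 \<le> ln pi"
    using pi_gt3 by simp
  finally show ?thesis using L by simp
qed

subsection \<open>The volume sequence\<close>

lemma less_add_two_real: "1 < real n + 2"
  by simp

lemma ln_ball_vol_root:
  assumes "1 < x"
  shows "ln (ball_vol_root x) + 1 / 2 =
    - (stirling_error_lim + ln 2 / 2) * ((1 - 1 / x) * (1 / ln x))
    + 1 / 4 * ((1 + 1 / x) * ((1 - 1 / x) * (1 / ln x)))
    + (stirling_error (x / 2) - stirling_error_lim) * (1 / x * (1 / ln x))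
    + (ln pi / 2 + ln 2 - 1 / 4 + stirling_error_lim) * (1 / ln x)
    + 1 / 2 * (1 / ln x - 1 / x)"
proof -
  have x: "ln x > 0" "x > 0" using assms by auto
  have G: "Gamma (1 + x / 2) > 0" using assms by (intro Gamma_real_pos) auto
  \<comment> \<open>In these variables the claim is a polynomial identity modulo
    \<open>x * y = 1\<close> and \<open>l * m = 1\<close>.\<close>
  define l y m e where "l = ln x" and "y = 1 / x" and "m = 1 / ln x" and "e = stirling_error (x / 2)"
  have inv: "x * y = 1" "l * m = 1" using x by (auto simp: l_def y_def m_def)
  have "ln (Gamma (1 + x / 2)) = (x / 2 + 1 / 2) * (l - ln 2) - x / 2 + y / 4 - e"
    using x by (simp add: stirling_error_def ln_div l_def y_def e_def)
  moreover have "ln (ball_vol_root x) = (x / 2 * ln pi - ln (Gamma (1 + x / 2))) * (y * m)"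
    using G by (simp add: ball_vol_root_def ln_powr ln_div y_def m_def)
  ultimately have "ln (ball_vol_root x) =
      (x / 2 * ln pi - ((x / 2 + 1 / 2) * (l - ln 2) - x / 2 + y / 4 - e)) * (y * m)"
    by simp
  then show ?thesis
    using inv unfolding y_def[symmetric] m_def[symmetric] e_def[symmetric] by algebra
qed

lemmas ln_ball_vol_root_nat = ln_ball_vol_root[OF less_add_two_real]

lemma cm_ln_ball_vol_root: "cm (\<lambda>n. ln (ball_vol_root (real n + 2)) + 1 / 2)"
proof -
  have x: "cm (\<lambda>n. 1 / (real n + 2))"
    using cm_inverse_affine[of 1 2] by simp
  then have x': "cm (\<lambda>n. 1 + 1 / (real n + 2))"
    by (intro cm_add cm_const) auto
  have e: "cm (\<lambda>n. stirling_error ((real n + 2) / 2) - stirling_error_lim)"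
    using cm_stirling_error[of "1 / 2" 1] by (simp add: add_divide_distrib)
  have "cm (\<lambda>n. - (stirling_error_lim + ln 2 / 2) * ((1 - 1 / (real n + 2)) * (1 / ln (real n + 2)))
    + 1 / 4 * ((1 + 1 / (real n + 2)) * ((1 - 1 / (real n + 2)) * (1 / ln (real n + 2))))
    + (stirling_error ((real n + 2) / 2) - stirling_error_lim) * (1 / (real n + 2) * (1 / ln (real n + 2)))
    + (ln pi / 2 + ln 2 - 1 / 4 + stirling_error_lim) * (1 / ln (real n + 2))
    + 1 / 2 * (1 / ln (real n + 2) - 1 / (real n + 2)))"
    using stirling_error_lim_upper stirling_error_lim_lower
    by (intro cm_add cm_cmult cm_inverse_ln_mult cm_inverse_ln cm_inverse_ln_minus'
        cm_mult[OF x' cm_inverse_ln_mult] cm_mult[OF e cm_mult[OF x cm_inverse_ln]]) simp_all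
  then show ?thesis
    by (simp only: ln_ball_vol_root_nat)
qed

lemma ball_vol_root_pos:
  assumes "1 < x"
  shows "0 < ball_vol_root x"
proof -
  have "Gamma (1 + x / 2) > 0" using assms by (intro Gamma_real_pos) auto
  then show ?thesis by (simp add: ball_vol_root_def)
qed

lemma cm_ball_vol_root: "cm (\<lambda>n. ball_vol_root (real n + 2))"
proof -
  have "cm (\<lambda>n. exp (- 1 / 2) * exp (ln (ball_vol_root (real n + 2)) + 1 / 2))"
    by (intro cm_cmult cm_exp cm_ln_ball_vol_root) auto
  also have "(\<lambda>n. exp (- 1 / 2) * exp (ln (ball_vol_root (real n + 2)) + 1 / 2)) =
      (\<lambda>n. ball_vol_root (real n + 2))"
    by (simp flip: exp_add) (simp add: ball_vol_root_pos)
  finally show ?thesis .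
qed

lemma ball_vol_root_tendsto: "(\<lambda>n. ball_vol_root (real n + 2)) \<longlonglongrightarrow> exp (- 1 / 2)"
proof -
  let ?e = "\<lambda>n. stirling_error ((real n + 2) / 2) - stirling_error_lim"
  \<comment> \<open>Boundedness of the remainder is enough, since its cofactor 1 / (x ln x) tends to
    0.\<close>
  have bound: "norm (?e n) \<le> 1" for n
  proof -
    have "1 / (8 * ((real n + 2) / 2)) \<le> 1"
      by (simp add: divide_le_eq)
    moreover have "stirling_error ((real n + 2) / 2) \<le> stirling_error_lim + 1 / (8 * ((real n + 2) / 2))"
      by (rule stirling_error_le) simp
    moreover have "stirling_error_lim \<le> stirling_error ((real n + 2) / 2)"
      by (rule stirling_error_lim_le) simp
    ultimately show ?thesis
      unfolding real_norm_def by linarith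
  qed
  have e: "(\<lambda>n. ?e n * (1 / (real n + 2) * (1 / ln (real n + 2)))) \<longlonglongrightarrow> 0"
  proof (rule lim_null_mult_left_bounded[where B = 1])
    show "\<forall>\<^sub>F n in sequentially. norm (?e n) \<le> 1"
      using bound by simp
    show "(\<lambda>n. 1 / (real n + 2) * (1 / ln (real n + 2))) \<longlonglongrightarrow> 0"
      by real_asymp
  qed
  have lims: "(\<lambda>n. (1 - 1 / (real n + 2)) * (1 / ln (real n + 2))) \<longlonglongrightarrow> 0"
    "(\<lambda>n. (1 + 1 / (real n + 2)) * ((1 - 1 / (real n + 2)) * (1 / ln (real n + 2)))) \<longlonglongrightarrow> 0"
    "(\<lambda>n. 1 / ln (real n + 2)) \<longlonglongrightarrow> 0"
    "(\<lambda>n. 1 / ln (real n + 2) - 1 / (real n + 2)) \<longlonglongrightarrow> 0"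
    by real_asymp+
  have "(\<lambda>n. - (stirling_error_lim + ln 2 / 2) * ((1 - 1 / (real n + 2)) * (1 / ln (real n + 2)))
    + 1 / 4 * ((1 + 1 / (real n + 2)) * ((1 - 1 / (real n + 2)) * (1 / ln (real n + 2))))
    + ?e n * (1 / (real n + 2) * (1 / ln (real n + 2)))
    + (ln pi / 2 + ln 2 - 1 / 4 + stirling_error_lim) * (1 / ln (real n + 2))
    + 1 / 2 * (1 / ln (real n + 2) - 1 / (real n + 2))) \<longlonglongrightarrow> 0"
    by (intro tendsto_add_zero tendsto_mult_right_zero e lims)
  then have "(\<lambda>n. ln (ball_vol_root (real n + 2)) + 1 / 2) \<longlonglongrightarrow> 0"
    by (simp only: ln_ball_vol_root_nat)
  then have "(\<lambda>n. exp (ln (ball_vol_root (real n + 2)) + 1 / 2 - 1 / 2)) \<longlonglongrightarrow> exp (0 - 1 / 2)"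
    by (intro tendsto_exp tendsto_diff tendsto_const)
  then show ?thesis
    by (simp add: ball_vol_root_pos)
qed

theorem corollary1p4:
  shows "(\<forall>n::nat. ball_vol_root (real (n + 2)) =
            unit_ball_vol (real (n + 2)) powr (1 / (real (n + 2) * ln (real (n + 2))))) \<and>
         hausdorff_moment_sequence (\<lambda>n. ball_vol_root (real (n + 2))) \<and>
         (\<lambda>n. ball_vol_root (real (n + 2))) \<longlonglongrightarrow> exp (- 1 / 2)"
  using cm_imp_hausdorff_moment_sequence[OF cm_ball_vol_root ball_vol_root_pos] ball_vol_root_tendsto
  by (simp add: ball_vol_root_altdef add.commute)

end
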